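(* Consider a proper discrete-time LTI system with the numerator $b(\mathfrak{q})=\sum_{i=0}^{d}b_i\mathfrak{q}^i$ and the denominator $a(\mathfrak{q})=\prod_{i=1}^{d}(\mathfrak{q}-p_i)$, where the poles $p_1,\dots,p_d$ are distinct and the dominant one $p$ (i.e., the one closest to the unit circle) satisfies $|p|<1$. Suppose the steady-state gain of the filter is $0$ (i.e., $b(1)=0$), the internal state (in the Jordan canonical form) is initiated at $X(0)$, and the input signal $u(t)$ is $0$ until time $k_0$ and takes possibly nonzero values for $t\ge k_0$. Then the output signal $y$ satisfies, at time $k$, the bound $$\|\mathbf{y}_n(k)\|_2\le \mathcal{C}_0\,\|X(0)\|_2\,|p|^{k-n}+\mathcal{C}_1\,\big\|\mu_{k-k_0}[u](k)\big\|_2\,|p|^{k-n-k_0}+\mathcal{C}_2\,\sqrt{k-k_0}\;V_{k-k_0}[u](k),$$ where the constants $\mathcal{C}_0,\mathcal{C}_1,\mathcal{C}_2$ are defined by $$r_i=\frac{b(p_i)}{\prod_{j\ne i}(p_i-p_j)},\qquad \mathcal{C}_0=\sqrt{n\sum_{i=1}^{d}r_i^2},\qquad \mathcal{C}_1=\frac{\sqrt{n\,d\sum_{i=1}^{d}r_i^2}}{1-|p|},\qquad \mathcal{C}_2=|b_d|+\sum_{i=1}^{d}\frac{|r_i|}{1-|p_i|}.$$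
   Context: Signals are functions of discrete time, and $\mathfrak{q}$ is the forward shift, $\mathfrak{q}[x(k)]=x(k+1)$. For a scalar signal $x$ and an integer $m\ge1$: $\mathbf{x}_m(k)=[x(k),x(k-1),\dots,x(k-m+1)]^{\intercal}$ collects the last $m$ values, $\mu_m[x](k)=\frac1m\sum_{i=0}^{m-1}x(k-i)$, and $V_m[x](k)\ge0$ is given by $V_m^2[x](k)=\frac1m\sum_{i=0}^{m-1}x^2(k-i)-(\mu_m[x](k))^2$. The integer $n\ge1$ is a given horizon, and $k>k_0$ so that windows of length $k-k_0$ make sense. The Jordan canonical realization is $X(t+1)=AX(t)+Bu(t)$, $y(t)=CX(t)+Du(t)$ with $A=\mathrm{diag}(p_1,\dots,p_d)$, $B=[1,\dots,1]^{\intercal}$, $C=[r_1,\dots,r_d]$, $D=b_d$.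
   Formalization: The input is assumed to vanish at time k_0 too (the bound fails otherwise); all poles satisfy |p_i|<1; for complex poles r_i^2 means |r_i|^2; the output window lies in times t≥0, k_0≥-1, and no negative power of 0 occurs when p=0. *)

theory Defs
  imports "HOL-Analysis.Analysis" "HOL-Computational_Algebra.Polynomial"
begin

text \<open>
  Discrete time is \<^typ>\<open>int\<close>, so the index \<open>k - i\<close> in a window is a genuine subtraction.
  The scalar type is an arbitrary \<^class>\<open>real_normed_field\<close>, which covers both real and complex
  poles; inputs are real signals.
\<close>

text \<open>The Euclidean norm of the stacked vector \<open>[x(k), x(k-1), \<dots>, x(k-m+1)]\<close>.\<close>

definition window_norm :: "nat \<Rightarrow> (int \<Rightarrow> 'a::real_normed_vector) \<Rightarrow> int \<Rightarrow> real" where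
  "window_norm m x k = L2_set (\<lambda>i. norm (x (k - int i))) {..<m}"

definition window_mean :: "nat \<Rightarrow> (int \<Rightarrow> real) \<Rightarrow> int \<Rightarrow> real" where
  "window_mean m x k = (1 / real m) * (\<Sum>i<m. x (k - int i))"

definition window_dev :: "nat \<Rightarrow> (int \<Rightarrow> real) \<Rightarrow> int \<Rightarrow> real" where
  "window_dev m x k =
     sqrt ((1 / real m) * (\<Sum>i<m. (x (k - int i))\<^sup>2) - (window_mean m x k)\<^sup>2)"

text \<open>The order \<open>d\<close> of the system is \<open>CARD('d)\<close>; the poles are indexed by \<open>'d\<close>.\<close>

definition denominator :: "('d::finite \<Rightarrow> 'a::real_normed_field) \<Rightarrow> 'a poly" where
  "denominator p = (\<Prod>i\<in>UNIV. [:- p i, 1:])"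

definition steady_state_gain ::
    "'a::real_normed_field poly \<Rightarrow> ('d::finite \<Rightarrow> 'a) \<Rightarrow> 'a" where
  "steady_state_gain b p = poly b 1 / poly (denominator p) 1"

definition dominant_pole :: "('d::finite \<Rightarrow> 'a::real_normed_field) \<Rightarrow> 'a \<Rightarrow> bool" where
  "dominant_pole p q \<longleftrightarrow>
     q \<in> range p \<and> (\<forall>i. infdist q (sphere 0 1) \<le> infdist (p i) (sphere 0 1))"

definition pole_residue ::
    "'a::real_normed_field poly \<Rightarrow> ('d::finite \<Rightarrow> 'a) \<Rightarrow> 'd \<Rightarrow> 'a" where
  "pole_residue b p i = poly b (p i) / (\<Prod>j\<in>UNIV - {i}. (p i - p j))"

definition jordan_A :: "('d::finite \<Rightarrow> 'a::real_normed_field) \<Rightarrow> 'a^'d^'d" where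
  "jordan_A p = (\<chi> i j. if i = j then p i else 0)"

definition jordan_B :: "'a::real_normed_field^'d::finite" where
  "jordan_B = (\<chi> i. 1)"

definition jordan_C ::
    "'a::real_normed_field poly \<Rightarrow> ('d::finite \<Rightarrow> 'a) \<Rightarrow> 'a^'d" where
  "jordan_C b p = (\<chi> i. pole_residue b p i)"

definition jordan_D :: "'a::real_normed_field poly \<Rightarrow> ('d::finite \<Rightarrow> 'a) \<Rightarrow> 'a" where
  "jordan_D b p = coeff b CARD('d)"

text \<open>The system runs from time \<open>0\<close>; nothing is required of \<open>X\<close> and \<open>y\<close> at negative times.\<close>

definition jordan_trajectory ::
    "'a::real_normed_field poly \<Rightarrow> ('d::finite \<Rightarrow> 'a) \<Rightarrow>
     (int \<Rightarrow> real) \<Rightarrow> (int \<Rightarrow> 'a^'d) \<Rightarrow> (int \<Rightarrow> 'a) \<Rightarrow> bool" where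
  "jordan_trajectory b p u X y \<longleftrightarrow>
     (\<forall>t\<ge>0. X (t + 1) = jordan_A p *v X t + of_real (u t) *s jordan_B \<and>
            y t = (\<Sum>i\<in>UNIV. jordan_C b p $ i * X t $ i) + jordan_D b p * of_real (u t))"

text \<open>
  The squares of the residues are squared moduli, as required for complex poles; for real scalars
  they are the plain squares.
\<close>

definition const_C0 :: "nat \<Rightarrow> 'a::real_normed_field poly \<Rightarrow> ('d::finite \<Rightarrow> 'a) \<Rightarrow> real" where
  "const_C0 n b p = sqrt (real n * (\<Sum>i\<in>UNIV. (norm (pole_residue b p i))\<^sup>2))"

definition const_C1 ::
    "nat \<Rightarrow> 'a::real_normed_field poly \<Rightarrow> ('d::finite \<Rightarrow> 'a) \<Rightarrow> 'a \<Rightarrow> real" where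
  "const_C1 n b p q =
     sqrt (real n * real CARD('d) * (\<Sum>i\<in>UNIV. (norm (pole_residue b p i))\<^sup>2)) / (1 - norm q)"

definition const_C2 :: "'a::real_normed_field poly \<Rightarrow> ('d::finite \<Rightarrow> 'a) \<Rightarrow> real" where
  "const_C2 b p =
     norm (coeff b CARD('d)) + (\<Sum>i\<in>UNIV. norm (pole_residue b p i) / (1 - norm (p i)))"

end

theory Submission
  imports Defs
begin

text \<open>
  The input splits on the window as \<open>u = \<mu> + v\<close> with \<open>\<mu>\<close> its mean.
  Each mode of the state then splits into a free response, the step response to \<open>\<mu>\<close>, and the
  response to \<open>v\<close>. As the gain vanishes, the partial fraction expansion of \<open>b / a\<close> at \<open>1\<close> cancels
  the stationary part of the step responses, so that the first two contributions decay
  geometrically. The third one obeys \<open>z (t + 1) = p z t + v t\<close> with \<open>z 0 = 0\<close>, so Minkowski's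
  inequality gives \<open>\<parallel>z\<parallel> \<le> |p| \<parallel>z\<parallel> + \<parallel>v\<parallel>\<close> for the Euclidean norm over the whole
  time range \<open>{0..k}\<close>.
\<close>

section \<open>Euclidean norms of signals over finite sets of times\<close>

lemma L2_set_norm_add:
  fixes f g :: "'b \<Rightarrow> 'a::real_normed_vector"
  shows "L2_set (\<lambda>t. norm (f t + g t)) A \<le> L2_set (\<lambda>t. norm (f t)) A + L2_set (\<lambda>t. norm (g t)) A"
proof -
  have "L2_set (\<lambda>t. norm (f t + g t)) A \<le> L2_set (\<lambda>t. norm (f t) + norm (g t)) A"
    by (intro L2_set_mono norm_triangle_ineq) auto
  also have "\<dots> \<le> L2_set (\<lambda>t. norm (f t)) A + L2_set (\<lambda>t. norm (g t)) A"
    by (rule L2_set_triangle_ineq)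
  finally show ?thesis .
qed

lemma L2_set_norm_sum:
  fixes f :: "'c \<Rightarrow> 'b \<Rightarrow> 'a::real_normed_vector"
  assumes "finite I"
  shows "L2_set (\<lambda>t. norm (\<Sum>i\<in>I. f i t)) A \<le> (\<Sum>i\<in>I. L2_set (\<lambda>t. norm (f i t)) A)"
  using assms
proof (induction I)
  case empty
  then show ?case by (simp add: L2_set_def)
next
  case (insert i I)
  then show ?case
    using L2_set_norm_add[of "f i" "\<lambda>t. \<Sum>i\<in>I. f i t" A] by simp
qed

lemma L2_set_norm_mult_left:
  fixes f :: "'b \<Rightarrow> 'a::real_normed_field"
  shows "L2_set (\<lambda>t. norm (c * f t)) A = norm c * L2_set (\<lambda>t. norm (f t)) A"
  by (simp add: norm_mult L2_set_right_distrib)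

lemma L2_set_mono_set:
  assumes "finite B" "A \<subseteq> B"
  shows "L2_set f A \<le> L2_set f B"
  unfolding L2_set_def by (intro real_sqrt_le_mono sum_mono2 assms) auto

lemma L2_set_le_sqrt_card:
  assumes "\<And>t. t \<in> A \<Longrightarrow> 0 \<le> f t" "\<And>t. t \<in> A \<Longrightarrow> f t \<le> c" "0 \<le> c"
  shows "L2_set f A \<le> sqrt (card A) * c"
  using L2_set_mono[of A f "\<lambda>_. c"] assms by (simp add: L2_set_constant)

section \<open>Sliding windows and their deviation\<close>

lemma window_norm_eq_L2_set:
  "window_norm m x k = L2_set (\<lambda>t. norm (x t)) {k - int m<..k}"
proof -
  have "(\<Sum>i<m. (norm (x (k - int i)))\<^sup>2) = (\<Sum>t\<in>{k - int m<..k}. (norm (x t))\<^sup>2)"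
    by (rule sum.reindex_bij_witness[of _ "\<lambda>t. nat (k - t)" "\<lambda>i. k - int i"]) auto
  then show ?thesis by (simp add: window_norm_def L2_set_def)
qed

text \<open>The variance identity: mean square minus squared mean is the mean squared deviation. It
  turns the third term of the bound into the norm of the centred input.\<close>

lemma sqrt_mult_window_dev:
  assumes "0 < m"
  shows "sqrt (real m) * window_dev m x k = window_norm m (\<lambda>t. x t - window_mean m x k) k"
proof -
  define \<mu> where "\<mu> = window_mean m x k"
  have s: "(\<Sum>i<m. x (k - int i)) = real m * \<mu>"
    using assms by (simp add: \<mu>_def window_mean_def)
  have "(\<Sum>i<m. (x (k - int i) - \<mu>)\<^sup>2)
      = (\<Sum>i<m. (x (k - int i))\<^sup>2) - 2 * \<mu> * (\<Sum>i<m. x (k - int i)) + real m * \<mu>\<^sup>2"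
    by (simp add: power2_diff sum.distrib sum_subtractf sum_distrib_left mult_ac)
  also have "\<dots> = real m * ((1 / real m) * (\<Sum>i<m. (x (k - int i))\<^sup>2) - \<mu>\<^sup>2)"
    using assms unfolding s by (simp add: field_simps power2_eq_square)
  finally show ?thesis
    by (simp add: window_norm_def window_dev_def L2_set_def real_sqrt_mult flip: \<mu>_def)
qed

section \<open>Modulus of the dominant pole\<close>

lemma infdist_unit_sphere:
  fixes q :: "'a::real_normed_field"
  assumes "norm q < 1"
  shows "infdist q (sphere 0 1) = 1 - norm q"
proof (rule antisym)
  \<comment> \<open>The radial projection of \<open>q\<close> is a nearest point; from 0 all points
    of the sphere are equally far, so 1 serves.\<close>
  define s where "s = (if q = 0 then 1 else q / of_real (norm q))"
  have "norm (q - s) = 1 - norm q"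
  proof (cases "q = 0")
    case False
    then have "q - s = q * of_real (1 - 1 / norm q)"
      by (simp add: s_def field_simps)
    then have "norm (q - s) = norm q * \<bar>1 - 1 / norm q\<bar>"
      by (simp only: norm_mult norm_of_real)
    also have "\<dots> = 1 - norm q"
      using False assms by (simp add: abs_if field_simps)
    finally show ?thesis .
  qed (simp add: s_def)
  moreover have "s \<in> sphere 0 1"
    by (simp add: s_def norm_divide)
  ultimately show "infdist q (sphere 0 1) \<le> 1 - norm q"
    using infdist_le[of s "sphere 0 1" q] by (simp add: dist_norm)
next
  have ne: "sphere (0::'a) 1 \<noteq> {}"
    by (auto intro!: exI[of _ 1])
  have "1 - norm q \<le> dist q a" if "a \<in> sphere 0 1" for a
    using that norm_triangle_ineq2[of a q] by (simp add: dist_norm norm_minus_commute)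
  then show "1 - norm q \<le> infdist q (sphere 0 1)"
    unfolding infdist_notempty[OF ne] by (intro cINF_greatest[OF ne])
qed

lemma dominant_pole_norm_le:
  fixes p :: "'d::finite \<Rightarrow> 'a::real_normed_field"
  assumes "dominant_pole p q" "\<forall>i. norm (p i) < 1"
  shows "norm (p i) \<le> norm q"
proof -
  have "norm q < 1" "infdist q (sphere 0 1) \<le> infdist (p i) (sphere 0 1)"
    using assms by (auto simp: dominant_pole_def)
  then show ?thesis
    using assms(2) by (simp add: infdist_unit_sphere)
qed

section \<open>Partial fractions of the transfer function\<close>

text \<open>Lagrange interpolation: once the multiple \<open>c\<close> of the denominator is removed
  from \<open>b\<close>, both sides have degree below the number of poles and agree at all of
  them.\<close>

lemma partial_fractions:
  fixes p :: "'d::finite \<Rightarrow> 'a::real_normed_field"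
  assumes deg: "degree b \<le> CARD('d)" and inj: "inj p" and x: "x \<notin> range p"
  shows "poly b x / poly (denominator p) x
    = coeff b CARD('d) + (\<Sum>i\<in>UNIV. pole_residue b p i / (x - p i))"
proof -
  define L where "L i = (\<Prod>j\<in>UNIV - {i}. [:- p j, 1:])" for i
  define c where "c = coeff b CARD('d)"
  define f where "f = b - smult c (denominator p)"
  define g where "g = (\<Sum>i\<in>UNIV. smult (pole_residue b p i) (L i))"
  have degL: "degree (L i) < CARD('d)" for i
  proof -
    have "degree (L i) = card (UNIV - {i})"
      unfolding L_def by (subst degree_prod_eq_sum_degree) auto
    then show ?thesis
      by (simp add: card_Diff_singleton)
  qed
  have degg: "degree g < CARD('d)"
    unfolding g_def
    by (intro degree_sum_less) (auto intro: le_less_trans[OF degree_smult_le] degL)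
  have degd: "degree (denominator p) = CARD('d)"
    unfolding denominator_def by (subst degree_prod_eq_sum_degree) auto
  \<comment> \<open>The denominator is monic, so subtracting \<open>c\<close> times it cancels the
    top coefficient of \<open>b\<close>.\<close>
  have "lead_coeff (denominator p) = 1"
    unfolding denominator_def lead_coeff_prod by simp
  then have "coeff f CARD('d) = 0"
    by (simp add: f_def c_def degd)
  moreover have "degree f \<le> CARD('d)"
    unfolding f_def using deg degd by (intro degree_diff_le) auto
  ultimately have degf: "degree f < CARD('d)"
    by (metis (no_types) eq_zero_or_degree_less degree_0 zero_less_card_finite)
  have polyL: "poly (L i) z = (\<Prod>j\<in>UNIV - {i}. z - p j)" for i z
    by (simp add: L_def poly_prod)
  have "f = g"
  proof (rule poly_eqI_degree[of "range p"])
    show "poly f z = poly g z" if "z \<in> range p" for z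
    proof -
      from that obtain i where z: "z = p i" by blast
      have "poly (denominator p) z = 0"
        by (auto simp: denominator_def poly_prod z intro!: prod_zero)
      then have "poly f z = poly b z" by (simp add: f_def)
      \<comment> \<open>Each \<open>L l\<close> with \<open>l\<close> other than \<open>i\<close>
        contains the factor vanishing at \<open>p i\<close>; the residue is normalised by the value
        of \<open>L i\<close> there.\<close>
      moreover have "poly g z = (\<Sum>l\<in>UNIV. if l = i then poly b z else 0)"
        unfolding g_def poly_sum
      proof (rule sum.cong[OF refl])
        fix l
        have "poly (L l) z = 0" if "l \<noteq> i"
          unfolding polyL using that by (auto simp: z intro!: prod_zero)
        moreover have "poly (L i) z \<noteq> 0"
          unfolding polyL using inj by (auto simp: z dest: injD)
        ultimately show "poly (smult (pole_residue b p l) (L l)) z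
            = (if l = i then poly b z else 0)"
          by (auto simp: pole_residue_def polyL z)
      qed
      ultimately show ?thesis by simp
    qed
  qed (use degf degg inj in \<open>auto simp: card_image\<close>)
  define D where "D = poly (denominator p) x"
  have D: "D = (x - p i) * poly (L i) x" for i
    by (simp add: D_def denominator_def L_def poly_prod prod.remove[of UNIV i] left_diff_distrib)
  have D0: "D \<noteq> 0"
    using x by (auto simp: D_def denominator_def poly_prod)
  have "poly b x = c * D + (\<Sum>i\<in>UNIV. pole_residue b p i * poly (L i) x)"
    using arg_cong[OF \<open>f = g\<close>, of "\<lambda>h. poly h x"]
    by (simp add: f_def g_def poly_sum D_def algebra_simps)
  also have "\<dots> / D = c + (\<Sum>i\<in>UNIV. pole_residue b p i * poly (L i) x / D)"
    using D0 by (simp add: add_divide_distrib sum_divide_distrib)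
  also have "(\<Sum>i\<in>UNIV. pole_residue b p i * poly (L i) x / D)
      = (\<Sum>i\<in>UNIV. pole_residue b p i / (x - p i))"
  proof (rule sum.cong[OF refl])
    fix i
    show "pole_residue b p i * poly (L i) x / D = pole_residue b p i / (x - p i)"
      using D0 unfolding D[of i] by simp
  qed
  finally show ?thesis by (simp add: c_def D_def)
qed

section \<open>Responses of single modes and their sums\<close>

lemma first_order_response_bound:
  fixes a :: "'a::real_normed_field" and z v :: "int \<Rightarrow> 'a"
  assumes a: "norm a < 1" and z0: "z 0 = 0"
    and step: "\<And>t. t \<ge> 0 \<Longrightarrow> z (t + 1) = a * z t + v t"
  shows "L2_set (\<lambda>t. norm (z t)) {0..k} \<le> L2_set (\<lambda>t. norm (v t)) {0..k} / (1 - norm a)"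
proof -
  let ?N = "\<lambda>x. L2_set (\<lambda>t. norm (x t)) {0..k}"
  \<comment> \<open>Since \<open>z 0 = 0\<close>, dropping time 0 costs nothing, and a shift by one
    step brings in the recursion.\<close>
  have "?N z = L2_set (\<lambda>t. norm (z t)) {1..k}"
    unfolding L2_set_def
  proof (intro arg_cong[where f = sqrt] sum.mono_neutral_right ballI)
    show "(norm (z t))\<^sup>2 = 0" if "t \<in> {0..k} - {1..k}" for t
    proof -
      from that have "t = 0" by auto
      then show ?thesis by (simp add: z0)
    qed
  qed auto
  also have "\<dots> = L2_set (\<lambda>t. norm (z (t + 1))) {0..k - 1}"
    unfolding L2_set_def
    by (rule arg_cong[where f = sqrt],
        rule sum.reindex_bij_witness[of _ "\<lambda>t. t + 1" "\<lambda>t. t - 1"]) auto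
  also have "\<dots> = L2_set (\<lambda>t. norm (a * z t + v t)) {0..k - 1}"
    by (intro L2_set_cong) (auto simp: step)
  also have "\<dots> \<le> L2_set (\<lambda>t. norm (a * z t + v t)) {0..k}"
    by (intro L2_set_mono_set) auto
  also have "\<dots> \<le> norm a * ?N z + ?N v"
    using L2_set_norm_add[of "\<lambda>t. a * z t" v] by (simp add: L2_set_norm_mult_left)
  finally have "?N z * (1 - norm a) \<le> ?N v"
    by (simp add: algebra_simps)
  then show ?thesis
    using a by (simp add: pos_le_divide_eq)
qed

text \<open>The target exponent may be negative. At \<open>r = 0\<close> this would give
  \<open>r powi e = 0\<close> while \<open>r ^ 0 = 1\<close>, hence the last assumption.\<close>

lemma power_le_powi:
  fixes r :: real
  assumes "0 \<le> r" "r \<le> 1" "e \<le> int m" "r = 0 \<Longrightarrow> 0 \<le> e"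
  shows "r ^ m \<le> r powi e"
proof (cases "r = 0")
  case False
  with assms show ?thesis
    using power_int_decreasing[of e "int m" r] by simp
next
  case True
  with assms show ?thesis
    by (cases "e = 0") (auto simp: power_int_def zero_power power_0_left)
qed

text \<open>Cauchy-Schwarz over the modes, after bounding every decay by the slowest. It serves for
  the initial state and for the transient of the step response.\<close>

lemma norm_modal_sum_le:
  fixes p r x :: "'d::finite \<Rightarrow> 'a::real_normed_field"
  assumes "\<And>i. norm (p i) \<le> q"
  shows "norm (\<Sum>i\<in>UNIV. r i * p i ^ m * x i)
    \<le> L2_set (\<lambda>i. norm (r i)) UNIV * L2_set (\<lambda>i. norm (x i)) UNIV * q ^ m"
proof -
  have "norm (\<Sum>i\<in>UNIV. r i * p i ^ m * x i) \<le> (\<Sum>i\<in>UNIV. norm (r i) * norm (x i) * q ^ m)"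
  proof (rule sum_norm_le)
    fix i
    have "norm (p i) ^ m \<le> q ^ m"
      by (intro power_mono assms) auto
    then have "(norm (r i) * norm (x i)) * norm (p i) ^ m \<le> (norm (r i) * norm (x i)) * q ^ m"
      by (intro mult_left_mono) auto
    then show "norm (r i * p i ^ m * x i) \<le> norm (r i) * norm (x i) * q ^ m"
      by (simp add: norm_mult norm_power mult_ac)
  qed
  also have "\<dots> = (\<Sum>i\<in>UNIV. norm (r i) * norm (x i)) * q ^ m"
    by (simp add: sum_distrib_right)
  also have "\<dots> \<le> L2_set (\<lambda>i. norm (r i)) UNIV * L2_set (\<lambda>i. norm (x i)) UNIV * q ^ m"
  proof (rule mult_right_mono)
    show "(\<Sum>i\<in>UNIV. norm (r i) * norm (x i))
        \<le> L2_set (\<lambda>i. norm (r i)) UNIV * L2_set (\<lambda>i. norm (x i)) UNIV"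
      using L2_set_mult_ineq[of "\<lambda>i. norm (r i)" "\<lambda>i. norm (x i)" UNIV] by simp
    have "0 \<le> q"
      using assms norm_ge_zero order_trans by blast
    then show "0 \<le> q ^ m" by simp
  qed
  finally show ?thesis .
qed

section \<open>Splitting the output and bounding its three parts\<close>

theorem lemma3p4:
  fixes b :: "'a::real_normed_field poly"
    and p :: "'d::finite \<Rightarrow> 'a"
    and p_dom :: 'a
    and u :: "int \<Rightarrow> real"
    and X :: "int \<Rightarrow> 'a^'d"
    and y :: "int \<Rightarrow> 'a"
    and n :: nat
    and k k0 :: int
  assumes proper: "degree b \<le> CARD('d)"
    and distinct: "inj p"
    and stable: "\<forall>i. norm (p i) < 1"
    and dominant: "dominant_pole p p_dom" "norm p_dom < 1"
    and gain: "steady_state_gain b p = 0"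
    and system: "jordan_trajectory b p u X y"
    and input: "\<forall>t\<le>k0. u t = 0"
    and times: "k0 \<ge> -1" "k > k0"
    and horizon: "n \<ge> 1" "int n \<le> k + 1"
    and exponents: "p_dom = 0 \<Longrightarrow> int n \<le> k \<and> int n \<le> k - k0"
  shows "window_norm n y k
      \<le> const_C0 n b p * norm (X 0) * norm p_dom powi (k - int n)
        + const_C1 n b p p_dom * norm (window_mean (nat (k - k0)) u k)
            * norm p_dom powi (k - int n - k0)
        + const_C2 b p * sqrt (real_of_int (k - k0)) * window_dev (nat (k - k0)) u k"
proof -
  define r where "r = pole_residue b p"
  define D where "D = coeff b CARD('d)"
  define q where "q = norm p_dom"
  define m where "m = nat (k - k0)"
  define \<mu> where "\<mu> = window_mean m u k"
  define v where "v t = u t - (if t > k0 then \<mu> else 0)" for t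
  \<comment> \<open>Response of mode \<open>i\<close> to a unit step starting at
    \<open>k0 + 1\<close>. The state reacts one sample later, hence the exponent.\<close>
  define step where "step i t = (if t > k0 then (1 - p i ^ nat (t - 1 - k0)) / (1 - p i) else 0)"
    for i t
  define z where "z i t = X t $ i - p i ^ nat t * X 0 $ i - of_real \<mu> * step i t" for i t
  define y1 where "y1 t = (\<Sum>i\<in>UNIV. r i * p i ^ nat t * X 0 $ i)" for t
  define y2 where "y2 t = (if t > k0 then
      - of_real \<mu> * (\<Sum>i\<in>UNIV. r i * p i ^ nat (t - 1 - k0) * (1 / (1 - p i))) else 0)" for t
  define y3 where "y3 t = (\<Sum>i\<in>UNIV. r i * z i t) + D * of_real (v t)" for t
  define R where "R = L2_set (\<lambda>i. norm (r i)) UNIV"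
  define W where "W = {k - int n<..k}"
  have q: "0 \<le> q" "q < 1" and pq: "norm (p i) \<le> q" for i
    using dominant dominant_pole_norm_le[OF dominant(1) stable] by (auto simp: q_def)
  have p1: "1 - p i \<noteq> 0" for i
    using stable[rule_format, of i] by auto
  then have "1 \<notin> range p" by (metis diff_self imageE)
  \<comment> \<open>Zero gain: the feedthrough cancels the stationary response of the modes.\<close>
  then have DR: "D = - (\<Sum>i\<in>UNIV. r i / (1 - p i))"
    using partial_fractions[OF proper distinct, of 1] gain
    by (simp add: steady_state_gain_def D_def r_def eq_neg_iff_add_eq_0)
  have Xstep: "X (t + 1) $ i = p i * X t $ i + of_real (u t)" if "t \<ge> 0" for t i
  proof -
    have "X (t + 1) $ i = (jordan_A p *v X t + of_real (u t) *s jordan_B) $ i"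
      using system that by (simp add: jordan_trajectory_def)
    also have "\<dots> = p i * X t $ i + of_real (u t)"
      by (simp add: jordan_A_def jordan_B_def matrix_vector_mult_def if_distrib[of "\<lambda>c. c * _"]
          cong: if_cong)
    finally show ?thesis .
  qed
  have zstep: "z i (t + 1) = p i * z i t + of_real (v t)" if t: "t \<ge> 0" for i t
  proof -
    \<comment> \<open>At \<open>t = k0\<close> the new exponent is 0, so the response is still
      0.\<close>
    have "step i (t + 1) = p i * step i t + (if t > k0 then 1 else 0)"
    proof (cases "t > k0")
      case True
      then have "nat (t + 1 - 1 - k0) = Suc (nat (t - 1 - k0))" by simp
      then show ?thesis
        using True p1[of i] by (simp add: step_def field_simps)
    qed (auto simp: step_def)
    then show ?thesis
      using t by (simp only: z_def v_def Xstep[OF t]) (simp add: nat_add_distrib algebra_simps)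
  qed
  \<comment> \<open>In the borderline case \<open>k0 = -1\<close> time 0 is already past
    \<open>k0\<close>, but the exponent in \<open>step\<close> is 0.\<close>
  have z0: "z i 0 = 0" for i
    using times(1) by (auto simp: z_def step_def)
  have ysplit: "y t = y1 t + y2 t + y3 t" if t: "t \<ge> 0" for t
  proof -
    have "y t = (\<Sum>i\<in>UNIV. r i * X t $ i) + D * of_real (u t)"
      using system t by (simp add: jordan_trajectory_def jordan_C_def jordan_D_def r_def D_def)
    also have "(\<Sum>i\<in>UNIV. r i * X t $ i)
        = y1 t + of_real \<mu> * (\<Sum>i\<in>UNIV. r i * step i t) + (\<Sum>i\<in>UNIV. r i * z i t)"
      by (simp add: y1_def z_def algebra_simps sum_distrib_left sum.distrib sum_subtractf)
    \<comment> \<open>By \<open>DR\<close> the stationary part is minus the feedthrough of the mean,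
      so only the transient \<open>y2\<close> survives in the output.\<close>
    also have "of_real \<mu> * (\<Sum>i\<in>UNIV. r i * step i t) = y2 t - D * of_real (u t - v t)"
      by (simp add: step_def y2_def v_def DR diff_divide_distrib right_diff_distrib
          sum_subtractf mult.commute)
    finally show ?thesis
      by (simp add: y3_def algebra_simps)
  qed
  have finW: "finite W" and cardW: "card W = n" and W0: "t \<in> W \<Longrightarrow> t \<ge> 0" for t
    using horizon by (auto simp: W_def)
  have b1: "L2_set (\<lambda>t. norm (y1 t)) W \<le> sqrt n * (R * norm (X 0) * q powi (k - int n))"
  proof -
    have "norm (y1 t) \<le> R * norm (X 0) * q powi (k - int n)" if t: "t \<in> W" for t
    proof -
      have "norm (y1 t) \<le> R * norm (X 0) * q ^ nat t"
        unfolding y1_def R_def norm_vec_def by (rule norm_modal_sum_le) (rule pq)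
      \<comment> \<open>Times in \<open>W\<close> exceed \<open>k - n\<close>, which is -1 when
        \<open>n = k + 1\<close>; \<open>exponents\<close> handles \<open>q = 0\<close>.\<close>
      also have "\<dots> \<le> R * norm (X 0) * q powi (k - int n)"
        using q t W0[OF t] exponents
        by (intro mult_left_mono power_le_powi) (auto simp: R_def W_def q_def)
      finally show ?thesis .
    qed
    then show ?thesis
      using L2_set_le_sqrt_card[of W "\<lambda>t. norm (y1 t)"] q
      by (simp add: cardW R_def)
  qed
  have b2: "L2_set (\<lambda>t. norm (y2 t)) W
      \<le> sqrt n * (\<bar>\<mu>\<bar> * (R * (sqrt CARD('d) / (1 - q)) * q powi (k - int n - k0)))"
    (is "_ \<le> sqrt n * ?c")
  proof -
    have c0: "0 \<le> ?c"
      using q by (simp add: R_def)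
    \<comment> \<open>Source of \<open>sqrt CARD('d)\<close> and of the denominator in
      \<open>const_C1\<close>.\<close>
    have L: "L2_set (\<lambda>i. norm (1 / (1 - p i))) UNIV \<le> sqrt CARD('d) * (1 / (1 - q))"
    proof (rule L2_set_le_sqrt_card)
      show "norm (1 / (1 - p i)) \<le> 1 / (1 - q)" for i
      proof -
        have "1 - q \<le> norm (1 - p i)"
          using norm_triangle_ineq2[of 1 "p i"] pq[of i] by simp
        then show ?thesis
          using q by (simp add: norm_divide frac_le)
      qed
    qed (use q in auto)
    have "norm (y2 t) \<le> ?c" if t: "t \<in> W" for t
    proof (cases "t > k0")
      case True
      let ?e = "nat (t - 1 - k0)"
      have "norm (\<Sum>i\<in>UNIV. r i * p i ^ ?e * (1 / (1 - p i)))
          \<le> R * L2_set (\<lambda>i. norm (1 / (1 - p i))) UNIV * q ^ ?e"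
        unfolding R_def by (rule norm_modal_sum_le) (rule pq)
      also have "\<dots> \<le> R * (sqrt CARD('d) * (1 / (1 - q))) * q powi (k - int n - k0)"
      proof (rule mult_mono)
        \<comment> \<open>The oldest sample of \<open>W\<close> is at \<open>k - n + 1\<close>; the
          delay in \<open>?e\<close> uses up the extra 1.\<close>
        show "q ^ ?e \<le> q powi (k - int n - k0)"
          using q t True exponents by (intro power_le_powi) (auto simp: W_def q_def)
        show "R * L2_set (\<lambda>i. norm (1 / (1 - p i))) UNIV \<le> R * (sqrt CARD('d) * (1 / (1 - q)))"
          by (intro mult_left_mono L) (simp add: R_def)
      qed (use q in \<open>auto simp: R_def\<close>)
      finally have "\<bar>\<mu>\<bar> * norm (\<Sum>i\<in>UNIV. r i * p i ^ ?e * (1 / (1 - p i))) \<le> ?c"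
        by (intro mult_left_mono) auto
      then show ?thesis
        using True by (simp add: y2_def norm_mult)
    next
      case False
      then show ?thesis
        using c0 by (simp add: y2_def)
    qed
    then show ?thesis
      using L2_set_le_sqrt_card[of W "\<lambda>t. norm (y2 t)" ?c] c0 by (simp add: cardW)
  qed
  define V where "V = sqrt (real_of_int (k - k0)) * window_dev m u k"
  have vV: "L2_set (\<lambda>t. norm (of_real (v t) :: 'a)) {0..k} = V"
  proof -
    \<comment> \<open>\<open>v\<close> vanishes up to \<open>k0\<close>, and \<open>k0 >= -1\<close>
      puts the whole input window inside \<open>{0..k}\<close>.\<close>
    have "L2_set (\<lambda>t. norm (of_real (v t) :: 'a)) {0..k} = L2_set (\<lambda>t. \<bar>v t\<bar>) {k0<..k}"
      unfolding L2_set_def norm_of_real using times input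
      by (intro arg_cong[where f = sqrt] sum.mono_neutral_cong_right) (auto simp: v_def)
    also have "\<dots> = window_norm m (\<lambda>t. u t - \<mu>) k"
      unfolding window_norm_eq_L2_set using times by (intro L2_set_cong) (auto simp: m_def v_def)
    also have "\<dots> = V"
      using times sqrt_mult_window_dev[of m u k] by (simp add: V_def \<mu>_def m_def)
    finally show ?thesis .
  qed
  have b3: "L2_set (\<lambda>t. norm (y3 t)) W \<le> const_C2 b p * V"
  proof -
    \<comment> \<open>Passing to the full time range makes \<open>first_order_response_bound\<close>
      applicable and keeps \<open>n\<close> out of \<open>const_C2\<close>.\<close>
    have "L2_set (\<lambda>t. norm (y3 t)) W \<le> L2_set (\<lambda>t. norm (y3 t)) {0..k}"
      using horizon by (intro L2_set_mono_set) (auto simp: W_def)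
    also have "\<dots> \<le> L2_set (\<lambda>t. norm (\<Sum>i\<in>UNIV. r i * z i t)) {0..k}
        + L2_set (\<lambda>t. norm (D * of_real (v t))) {0..k}"
      unfolding y3_def by (rule L2_set_norm_add)
    also have "L2_set (\<lambda>t. norm (D * of_real (v t))) {0..k} = norm D * V"
      unfolding L2_set_norm_mult_left vV ..
    also have "L2_set (\<lambda>t. norm (\<Sum>i\<in>UNIV. r i * z i t)) {0..k}
        \<le> (\<Sum>i\<in>UNIV. norm (r i) * (V / (1 - norm (p i))))"
    proof -
      have "L2_set (\<lambda>t. norm (z i t)) {0..k} \<le> V / (1 - norm (p i))" for i
        using first_order_response_bound[of "p i" "z i" "\<lambda>t. of_real (v t)" k]
          stable z0 zstep vV by simp
      then have "(\<Sum>i\<in>UNIV. L2_set (\<lambda>t. norm (r i * z i t)) {0..k})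
          \<le> (\<Sum>i\<in>UNIV. norm (r i) * (V / (1 - norm (p i))))"
        unfolding L2_set_norm_mult_left by (intro sum_mono mult_left_mono) auto
      then show ?thesis
        by (rule order_trans[OF L2_set_norm_sum[OF finite]])
    qed
    finally show ?thesis
      by (simp add: const_C2_def r_def D_def distrib_right sum_distrib_right add.commute)
  qed
  have "window_norm n y k = L2_set (\<lambda>t. norm (y1 t + y2 t + y3 t)) W"
    unfolding window_norm_eq_L2_set W_def[symmetric]
    by (intro L2_set_cong) (auto simp: ysplit W0)
  also have "\<dots> \<le> L2_set (\<lambda>t. norm (y1 t)) W + L2_set (\<lambda>t. norm (y2 t)) W
      + L2_set (\<lambda>t. norm (y3 t)) W"
    using L2_set_norm_add[of "\<lambda>t. y1 t + y2 t" y3 W] L2_set_norm_add[of y1 y2 W] by linarith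
  also have "\<dots> \<le> sqrt n * (R * norm (X 0) * q powi (k - int n))
      + sqrt n * (\<bar>\<mu>\<bar> * (R * (sqrt CARD('d) / (1 - q)) * q powi (k - int n - k0)))
      + const_C2 b p * V"
    by (intro add_mono b1 b2 b3)
  also have "sqrt n * (R * norm (X 0) * q powi (k - int n))
      = const_C0 n b p * norm (X 0) * q powi (k - int n)"
    by (simp add: const_C0_def R_def r_def L2_set_def real_sqrt_mult)
  also have "sqrt n * (\<bar>\<mu>\<bar> * (R * (sqrt CARD('d) / (1 - q)) * q powi (k - int n - k0)))
      = const_C1 n b p p_dom * norm \<mu> * q powi (k - int n - k0)"
    by (simp add: const_C1_def R_def r_def q_def L2_set_def real_sqrt_mult)
  finally show ?thesis
    by (simp add: V_def m_def \<mu>_def q_def mult_ac)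
qed

end
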